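(* (Bialternant formula.) Let $n\ge 1$ and let $\lambda=(\lambda_1,\ldots,\lambda_n)$ be a partition with at most $n$ nonzero parts. Then $$s_\lambda(x_1,\ldots,x_n)=\left.\det\bigl(x_i^{\lambda_j+n-j}\bigr)_{1\le i,j\le n}\right/\det\bigl(x_i^{n-j}\bigr)_{1\le i,j\le n}.$$
   Context: $x_1,\ldots,x_n$ are independent commuting variables. $h_r=h_r(x_1,\ldots,x_n)$ is the complete symmetric polynomial, $\sum_{r\ge 0}h_rt^r=\prod_{i=1}^n(1-x_it)^{-1}$, with $h_0=1$ and $h_r=0$ for $r<0$; set $h_\alpha=\prod_i h_{\alpha_i}$ for any integer sequence $\alpha$ with finitely many nonzero terms. For $i<j$ let $R_{ij}(\alpha)=(\alpha_1,\ldots,\alpha_i+1,\ldots,\alpha_j-1,\ldots)$, and for a monomial $R$ in the $R_{ij}$ let $R\,h_\alpha:=h_{R\alpha}$ (the operator acts on the index). The Schur polynomial is defined by $s_\lambda:=\prod_{i<j}(1-R_{ij})\,h_\lambda=\det(h_{\lambda_i+j-i})_{i,j}$. *)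

theory Defs
  imports
    "HOL-Library.Poly_Mapping"
    "HOL-Computational_Algebra.Formal_Power_Series"
    "HOL-Computational_Algebra.Fraction_Field"
    "Jordan_Normal_Form.Determinant"
begin

text \<open>
  Indices are 0-based throughout: the variables \<open>x\<^sub>1, \<dots>, x\<^sub>n\<close> are \<open>X 0, \<dots>, X (n - 1)\<close>, and the
  entries of an integer sequence \<open>\<alpha>\<close> are \<open>\<alpha> 0, \<alpha> 1, \<dots>\<close>.

  Polynomials have integer coefficients. They live in the polynomial ring over countably many
  variables, of which only the first \<open>n\<close> are used.
\<close>

type_synonym zpoly = "(nat \<Rightarrow>\<^sub>0 nat) \<Rightarrow>\<^sub>0 int"

definition X :: "nat \<Rightarrow> zpoly" where
  "X i = Poly_Mapping.single (Poly_Mapping.single i 1) 1"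

text \<open>
  The ring of polynomials has no inverse operation, so the inverse power series is formed with
  \<^const>\<open>fps_right_inverse_constructor\<close>, whose last argument is the inverse of the constant
  coefficient (here 1).
\<close>

definition complete_gf :: "nat \<Rightarrow> zpoly fps" where
  "complete_gf n = fps_right_inverse (\<Prod>i<n. 1 - fps_const (X i) * fps_X) 1"

lemma complete_gf_inverse:
  "(\<Prod>i<n. 1 - fps_const (X i) * fps_X) * complete_gf n = 1"
proof -
  have "fps_nth (\<Prod>i<n. 1 - fps_const (X i) * fps_X) 0 = (1 :: zpoly)"
    by (induction n) simp_all
  then show ?thesis
    unfolding complete_gf_def by (intro fps_right_inverse) simp
qed

definition complete_sym :: "nat \<Rightarrow> int \<Rightarrow> zpoly" where
  "complete_sym n r = (if r < 0 then 0 else fps_nth (complete_gf n) (nat r))"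

lemma complete_sym_0 [simp]: "complete_sym n 0 = 1"
  by (simp add: complete_sym_def complete_gf_def)

text \<open>The product ranges over the support of \<open>\<alpha>\<close>, as the remaining factors equal \<open>h\<^sub>0 = 1\<close>.\<close>

definition complete_seq :: "nat \<Rightarrow> (nat \<Rightarrow> int) \<Rightarrow> zpoly" where
  "complete_seq n \<alpha> = (\<Prod>i | \<alpha> i \<noteq> 0. complete_sym n (\<alpha> i))"

definition raising :: "nat \<Rightarrow> nat \<Rightarrow> (nat \<Rightarrow> int) \<Rightarrow> nat \<Rightarrow> int" where
  "raising i j \<alpha> = \<alpha>(i := \<alpha> i + 1, j := \<alpha> j - 1)"

text \<open>The monomial given by the product of all \<open>R\<^sub>i\<^sub>j\<close> with \<open>(i, j) \<in> P\<close>, for finite \<open>P\<close>.\<close>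

definition raising_monomial :: "(nat \<times> nat) set \<Rightarrow> (nat \<Rightarrow> int) \<Rightarrow> nat \<Rightarrow> int" where
  "raising_monomial P \<alpha> = Finite_Set.fold (\<lambda>(i, j). raising i j) \<alpha> P"

lemma comp_fun_commute_raising: "comp_fun_commute (\<lambda>(i, j). raising i j)"
  by standard (auto simp: raising_def fun_eq_iff)

lemma raising_monomial_empty [simp]: "raising_monomial {} \<alpha> = \<alpha>"
  by (simp add: raising_monomial_def)

lemma raising_monomial_insert:
  assumes "finite P" "(i, j) \<notin> P"
  shows "raising_monomial (insert (i, j) P) \<alpha> = raising i j (raising_monomial P \<alpha>)"
  using comp_fun_commute_on.fold_insert[OF comp_fun_commute_raising[unfolded comp_fun_commute_def'],
      of "(i, j)" P] assms
  by (simp add: raising_monomial_def)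

text \<open>
  Expanding the product over all pairs \<open>i < j\<close> gives
  \[ \prod_{i<j} (1 - R_{ij})\, h_\alpha = \sum_P (-1)^{|P|} h_{R_P \alpha}, \qquad
     R_P = \prod_{(i,j) \in P} R_{ij}, \]
  where \<open>P\<close> ranges over the finite sets of pairs \<open>i < j\<close>. For finitely supported \<open>\<alpha>\<close> only finitely
  many summands are nonzero (see \<open>finite_schur_support\<close> below), so
  \<open>Sum_any\<close>, which is 0 on infinite support, takes its intended value.
\<close>

definition schur_summand :: "nat \<Rightarrow> (nat \<Rightarrow> int) \<Rightarrow> (nat \<times> nat) set \<Rightarrow> zpoly" where
  "schur_summand n \<alpha> P =
     (if finite P \<and> P \<subseteq> {(i, j). i < j}
      then (- 1) ^ card P * complete_seq n (raising_monomial P \<alpha>) else 0)"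

definition schur :: "nat \<Rightarrow> (nat \<Rightarrow> int) \<Rightarrow> zpoly" where
  "schur n \<alpha> = Sum_any (schur_summand n \<alpha>)"

lemma raising_monomial_eq:
  assumes "finite P" "\<And>i j. (i, j) \<in> P \<Longrightarrow> i \<noteq> j"
  shows "raising_monomial P \<alpha> k =
    \<alpha> k + int (card {p \<in> P. fst p = k}) - int (card {p \<in> P. snd p = k})"
  using assms
proof (induction P)
  case empty
  then show ?case by simp
next
  case (insert p P)
  obtain i j where p: "p = (i, j)" by force
  have ij: "i \<noteq> j" using insert.prems p by blast
  have 1: "{q \<in> insert p P. fst q = k} =
      (if i = k then insert p {q \<in> P. fst q = k} else {q \<in> P. fst q = k})"
    using p by auto
  have 2: "{q \<in> insert p P. snd q = k} =
      (if j = k then insert p {q \<in> P. snd q = k} else {q \<in> P. snd q = k})"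
    using p by auto
  have IH: "raising_monomial P \<alpha> k =
      \<alpha> k + int (card {p \<in> P. fst p = k}) - int (card {p \<in> P. snd p = k})"
    using insert.IH insert.prems by blast
  show ?case
    unfolding 1 2
    using insert.hyps p ij IH
    by (auto simp: raising_monomial_insert raising_def)
qed

lemma schur_summand_nonzero_bound:
  assumes \<alpha>: "\<And>i. i \<ge> N \<Longrightarrow> \<alpha> i = 0" and nz: "schur_summand n \<alpha> P \<noteq> 0"
  shows "P \<subseteq> {(i, j). i < j \<and> j < N}"
proof (rule ccontr)
  have fin: "finite P" and P: "P \<subseteq> {(i, j). i < j}"
    using nz by (auto simp: schur_summand_def split: if_splits)
  have P_neq: "\<And>i j. (i, j) \<in> P \<Longrightarrow> i \<noteq> j" using P by auto
  assume "\<not> ?thesis"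
  then obtain p where p: "p \<in> P" "snd p \<ge> N"
    using P by fastforce
  define m where "m = Max (snd ` P)"
  have m_in: "m \<in> snd ` P" and m_ge: "\<And>q. q \<in> P \<Longrightarrow> snd q \<le> m"
    using p(1) fin unfolding m_def by (auto intro!: Max_in)
  have mN: "m \<ge> N" using m_ge[OF p(1)] p(2) by simp
  have 1: "{q \<in> P. fst q = m} = {}"
    using P m_ge by fastforce
  have "card {q \<in> P. snd q = m} > 0"
    using m_in fin by (auto simp: card_gt_0_iff)
  then have neg: "raising_monomial P \<alpha> m < 0"
    using raising_monomial_eq[OF fin P_neq, of \<alpha> m] \<alpha>[OF mN] 1 by simp
  have supp: "finite {k. raising_monomial P \<alpha> k \<noteq> 0}"
  proof (rule finite_subset)
    show "{k. raising_monomial P \<alpha> k \<noteq> 0} \<subseteq> {..<N} \<union> fst ` P \<union> snd ` P"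
    proof
      fix k assume "k \<in> {k. raising_monomial P \<alpha> k \<noteq> 0}"
      then have k: "raising_monomial P \<alpha> k \<noteq> 0" by simp
      show "k \<in> {..<N} \<union> fst ` P \<union> snd ` P"
      proof (rule ccontr)
        assume c: "k \<notin> {..<N} \<union> fst ` P \<union> snd ` P"
        then have e: "{p \<in> P. fst p = k} = {}" "{p \<in> P. snd p = k} = {}"
          by (force simp: image_iff)+
        have "\<alpha> k = 0" using c \<alpha>[of k] by simp
        then show False
          using raising_monomial_eq[OF fin P_neq, of \<alpha> k, unfolded e] k by simp
      qed
    qed
  qed (use fin in auto)
  have "complete_seq n (raising_monomial P \<alpha>) = 0"
    unfolding complete_seq_def
    using supp neg by (intro prod_zero) (auto simp: complete_sym_def intro!: exI[of _ m])
  then show False using nz by (simp add: schur_summand_def split: if_splits)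
qed

lemma finite_schur_support:
  assumes "finite {i. \<alpha> i \<noteq> 0}"
  shows "finite {P. schur_summand n \<alpha> P \<noteq> 0}"
proof -
  obtain N where N: "{i. \<alpha> i \<noteq> 0} \<subseteq> {..<N}"
    using assms finite_nat_iff_bounded by blast
  then have "\<And>i. i \<ge> N \<Longrightarrow> \<alpha> i = 0" by force
  then have "{P. schur_summand n \<alpha> P \<noteq> 0} \<subseteq> Pow ({..<N} \<times> {..<N})"
    using schur_summand_nonzero_bound[of N \<alpha> n] by fastforce
  then show ?thesis by (rule finite_subset) simp
qed

text \<open>Hence it makes no difference whether \<open>j\<close> ranges over all indices or stops at the length.\<close>

lemma schur_eq_finite_sum:
  assumes "\<And>i. i \<ge> N \<Longrightarrow> \<alpha> i = 0"
  shows "schur n \<alpha> = (\<Sum>P\<in>Pow {(i, j). i < j \<and> j < N}.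
           (- 1) ^ card P * complete_seq n (raising_monomial P \<alpha>))"
proof -
  have fin: "finite {(i, j). i < j \<and> j < N}"
    by (rule finite_subset[of _ "{..<N} \<times> {..<N}"]) auto
  have "schur n \<alpha> = sum (schur_summand n \<alpha>) (Pow {(i, j). i < j \<and> j < N})"
    unfolding schur_def
    using schur_summand_nonzero_bound[of N \<alpha> n] assms fin
    by (intro Sum_any.expand_superset) auto
  also have "\<dots> = (\<Sum>P\<in>Pow {(i, j). i < j \<and> j < N}.
           (- 1) ^ card P * complete_seq n (raising_monomial P \<alpha>))"
    using fin by (intro sum.cong) (auto simp: schur_summand_def dest: finite_subset)
  finally show ?thesis .
qed

lemma X_power: "X i ^ k = Poly_Mapping.single (Poly_Mapping.single i k) 1"
  by (induction k) (simp_all add: X_def mult_single single_add [symmetric] single_zero)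

lemma prod_single:
  "finite A \<Longrightarrow> (\<Prod>i\<in>A. Poly_Mapping.single (m i) (1 :: int)) =
    Poly_Mapping.single (\<Sum>i\<in>A. m i :: nat \<Rightarrow>\<^sub>0 nat) 1"
  by (induction A rule: finite_induct) (simp_all add: mult_single)

text \<open>In particular (\<open>e j = n - 1 - j\<close>) the denominator of the bialternant formula does not vanish.\<close>

lemma alternant_nonzero:
  assumes inj: "inj_on e {..<n}"
  shows "det (mat n n (\<lambda>(i, j). X i ^ e j)) \<noteq> (0 :: zpoly)"
proof -
  let ?D = "det (mat n n (\<lambda>(i, j). X i ^ e j)) :: zpoly"
  define mon where "mon p = (\<Sum>i = 0..<n. Poly_Mapping.single i (e (p i)) :: nat \<Rightarrow>\<^sub>0 nat)" for p
  have mon_lookup: "Poly_Mapping.lookup (mon p) i = e (p i)" if "i < n" for p i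
  proof -
    have "Poly_Mapping.lookup (mon p) i = (\<Sum>k = 0..<n. if k = i then e (p k) else 0)"
      unfolding mon_def lookup_sum
      by (intro sum.cong) (auto simp: lookup_single when_def)
    then show ?thesis using that by simp
  qed
  have eq: "p = id" if p: "p permutes {0..<n}" and m: "mon p = mon id" for p
  proof
    fix i
    show "p i = id i"
    proof (cases "i < n")
      case True
      then have "p i < n" using permutes_in_image[OF p, of i] by simp
      moreover have "e (p i) = e i" using mon_lookup[OF True, of p] mon_lookup[OF True, of id] m by simp
      ultimately show ?thesis using inj True by (auto dest: inj_onD)
    next
      case False
      then show ?thesis using permutes_not_in[OF p, of i] by simp
    qed
  qed
  have "?D = (\<Sum>p | p permutes {0..<n}. signof p * Poly_Mapping.single (mon p) 1)"
    unfolding det_def mon_def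
    by (auto simp: X_power prod_single[symmetric] permutes_in_image intro!: sum.cong prod.cong)
  then have "Poly_Mapping.lookup (?D) (mon id) =
      (\<Sum>p | p permutes {0..<n}. Poly_Mapping.lookup (signof p * Poly_Mapping.single (mon p) 1) (mon id))"
    by (simp add: lookup_sum)
  also have "\<dots> = (\<Sum>p | p permutes {0..<n}. if p = id then 1 else 0)"
  proof (intro sum.cong refl)
    fix p assume "p \<in> {p. p permutes {0..<n}}"
    then show "Poly_Mapping.lookup (signof p * Poly_Mapping.single (mon p) 1) (mon id) =
        (if p = id then 1 else (0 :: int))"
      using eq[of p] by (cases "evenperm p") (auto simp: sign_def lookup_single when_def)
  qed
  also have "\<dots> = 1"
    by (simp add: finite_permutations permutes_id)
  finally show ?thesis by force
qed

end

theory Submission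
  imports Defs
begin

text \<open>
  Write \<open>\<delta> = (n - 1, \<dots>, 1, 0)\<close> and \<open>a\<^sub>\<mu> = det (x\<^sub>i ^ \<mu>\<^sub>j)\<close>. The proof diagonalises the raising
  operators. Decomposing the generating function \<open>1 / (\<Prod>i<n. 1 - x\<^sub>i t)\<close> into partial fractions gives,
  over the field of fractions,
  \[ h_r = \sum_{i<n} u_i x_i^r, \qquad u_i = \prod_{j \neq i} (1 - x_j / x_i)^{-1}, \]
  and, since the sum on the right vanishes for \<open>-n < r < 0\<close>, this also holds for those \<open>r\<close>
  (\<open>complete_sym_partial_fractions\<close>). The indices produced by the raising operators never drop to
  \<open>-n\<close> or below, as each position \<open>k\<close> is lowered at most \<open>k\<close> times.

  So every product \<open>h\<^sub>\<beta>\<close> is a sum, over all functions \<open>f\<close> from \<open>{..<n}\<close> to itself, of a constant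
  times the monomial with factors \<open>x\<^bsub>f(k)\<^esub>\<close> to the power \<open>\<beta>\<^sub>k\<close>. On such a monomial \<open>R\<^sub>i\<^sub>j\<close> acts as
  multiplication by \<open>x\<^bsub>f(i)\<^esub> / x\<^bsub>f(j)\<^esub>\<close>, and therefore \<open>\<Prod>i<j. 1 - R\<^sub>i\<^sub>j\<close> kills all \<open>f\<close> that are not
  injective. What is left is a sum over permutations (\<open>schur_eq_sum_permutes\<close>). In it the difference
  product \<open>\<Prod>i<j. x\<^bsub>p(j)\<^esub> - x\<^bsub>p(i)\<^esub>\<close> contributes the sign of \<open>p\<close> (\<open>diff_prod_permutes\<close>), so that the sum
  is the Leibniz expansion of \<open>a\<^bsub>\<lambda>+\<delta>\<^esub>\<close>, up to a factor \<open>K\<close> that does not depend on \<open>\<lambda>\<close>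
  (\<open>schur_proportional_alternant\<close>). The case \<open>\<lambda> = 0\<close>, where \<open>s\<^sub>\<lambda> = 1\<close>, determines \<open>K = 1 / a\<^sub>\<delta>\<close> without
  evaluating the Vandermonde determinant.
\<close>

section \<open>Partial fractions\<close>

text \<open>
  The factor \<open>x i - x l\<close> cancels against the denominator and removes the summand \<open>i = l\<close>. Subtracting
  two instances gives the recursion of divided differences that drives the next induction.
\<close>

lemma sum_partial_fractions_remove:
  fixes x :: "'i \<Rightarrow> 'a::field"
  assumes "finite S" "inj_on x S" "l \<in> S"
  shows "(\<Sum>i\<in>S. (x i - x l) * (x i ^ m / (\<Prod>j\<in>S - {i}. x i - x j))) =
    (\<Sum>i\<in>S - {l}. x i ^ m / (\<Prod>j\<in>S - {l} - {i}. x i - x j))"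
proof -
  have "(x i - x l) * (x i ^ m / (\<Prod>j\<in>S - {i}. x i - x j)) =
      x i ^ m / (\<Prod>j\<in>S - {l} - {i}. x i - x j)" if "i \<in> S - {l}" for i
  proof -
    have "x i \<noteq> x l" using that assms by (auto dest: inj_onD)
    moreover have "(\<Prod>j\<in>S - {i}. x i - x j) = (x i - x l) * (\<Prod>j\<in>S - {l} - {i}. x i - x j)"
      using that assms prod.remove[of "S - {i}" l "\<lambda>j. x i - x j"]
      by (auto simp: Diff_insert2[of S l "{i}"] simp flip: Diff_insert)
    ultimately show ?thesis by simp
  qed
  then show ?thesis
    using assms by (subst sum.remove[of _ l]) auto
qed

text \<open>
  For the left factor \<open>G S\<close> the previous lemma gives
  \<open>(x k - x l) G S = G (S - {l}) - G (S - {k})\<close>. Multiplication by the product over all of \<open>S\<close> restores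
  in each term on the right just the one linear factor that the induction hypothesis does not absorb,
  and the difference of these two factors is \<open>(x k - x l) t\<close>. The power of \<open>t\<close> on the
  right-hand side says that the coefficients of \<open>G S\<close> of index less than \<open>card S - 1\<close> vanish.
\<close>

lemma partial_fractions_gf:
  fixes x :: "'i \<Rightarrow> 'a::field"
  assumes "finite S" "inj_on x S" "S \<noteq> {}"
  shows "Abs_fps (\<lambda>m. \<Sum>i\<in>S. x i ^ m / (\<Prod>j\<in>S - {i}. x i - x j)) *
    (\<Prod>i\<in>S. 1 - fps_const (x i) * fps_X) = fps_X ^ (card S - 1)"
  using assms
proof (induction S rule: finite_psubset_induct)
  case (psubset S)
  define G where "G T = Abs_fps (\<lambda>m. \<Sum>i\<in>T. x i ^ m / (\<Prod>j\<in>T - {i}. x i - x j))" for T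
  define E where "E T = (\<Prod>i\<in>T. 1 - fps_const (x i) * fps_X)" for T
  obtain k where k: "k \<in> S" using psubset.prems by blast
  show ?case
  proof (cases "S = {k}")
    case True
    have "Abs_fps (\<lambda>m. x k ^ m) * (1 - fps_const (x k) * fps_X) = 1"
    proof (rule fps_ext)
      fix m
      show "fps_nth (Abs_fps (\<lambda>m. x k ^ m) * (1 - fps_const (x k) * fps_X)) m = fps_nth 1 m"
        by (cases m) (simp_all add: right_diff_distrib fps_X_mult_right_nth flip: mult.assoc)
    qed
    then show ?thesis using True by simp
  next
    case False
    then obtain l where l: "l \<in> S" "l \<noteq> k" using k by blast
    have ne: "x k \<noteq> x l" using k l psubset.prems by (auto dest: inj_onD)
    have IH: "G (S - {a}) * E (S - {a}) = fps_X ^ (card S - 2)" if "a \<in> S" for a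
    proof -
      have "S - {a} \<noteq> {}" using k l that by blast
      then have "G (S - {a}) * E (S - {a}) = fps_X ^ (card (S - {a}) - 1)"
        unfolding G_def E_def
        using that psubset.prems by (intro psubset.IH) (auto intro: inj_on_subset)
      then show ?thesis
        using that psubset.hyps by (simp add: numeral_2_eq_2)
    qed
    have E: "E S = (1 - fps_const (x a) * fps_X) * E (S - {a})" if "a \<in> S" for a
      unfolding E_def using that psubset.hyps by (simp add: prod.remove)
    have card: "card S \<ge> 2"
      using card_mono[of S "{k, l}"] k l psubset.hyps by simp
    have G: "fps_const (x k - x l) * G S = G (S - {l}) - G (S - {k})"
    proof (rule fps_ext)
      fix m
      define c where "c i = x i ^ m / (\<Prod>j\<in>S - {i}. x i - x j)" for i
      have "fps_nth (G (S - {a})) m = (\<Sum>i\<in>S. (x i - x a) * c i)" if "a \<in> S" for a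
        unfolding G_def c_def using sum_partial_fractions_remove[of S x a m] that psubset by simp
      moreover have "(x k - x l) * c i = (x i - x l) * c i - (x i - x k) * c i" for i
        by (simp add: algebra_simps)
      ultimately show
        "fps_nth (fps_const (x k - x l) * G S) m = fps_nth (G (S - {l}) - G (S - {k})) m"
        using k l by (simp add: G_def sum_distrib_left sum_subtractf flip: c_def)
    qed
    have "fps_const (x k - x l) * (G S * E S) = G (S - {l}) * E S - G (S - {k}) * E S"
      by (simp add: G left_diff_distrib flip: mult.assoc)
    also have "G (S - {l}) * E S = (1 - fps_const (x l) * fps_X) * fps_X ^ (card S - 2)"
      using E[OF l(1)] IH[OF l(1)] by (simp add: ac_simps)
    also have "G (S - {k}) * E S = (1 - fps_const (x k) * fps_X) * fps_X ^ (card S - 2)"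
      using E[OF k] IH[OF k] by (simp add: ac_simps)
    also have "(1 - fps_const (x l) * fps_X) * fps_X ^ (card S - 2) -
        (1 - fps_const (x k) * fps_X) * fps_X ^ (card S - 2) =
        fps_const (x k - x l) * (fps_X * fps_X ^ (card S - 2))"
      by (simp add: algebra_simps flip: fps_const_sub)
    also have "fps_X * fps_X ^ (card S - 2) = fps_X ^ (card S - 1)"
      using card by (simp add: numeral_2_eq_2 Suc_diff_Suc flip: power_Suc)
    finally have "G S * E S = fps_X ^ (card S - 1)"
      using ne by simp
    then show ?thesis unfolding G_def E_def .
  qed
qed

section \<open>The variables in the fraction field\<close>

abbreviation \<xi> :: "nat \<Rightarrow> zpoly fract" where
  "\<xi> i \<equiv> to_fract (X i)"

lemma X_nonzero: "X i \<noteq> 0"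
  by (simp add: X_def)

lemma inj_X: "inj X"
  by (rule injI) (metis X_def lookup_single_eq lookup_single_not_eq one_neq_zero)

lemma inj_x: "inj_on \<xi> S"
  using inj_X by (auto simp: inj_on_def)

lemma to_fract_prod: "to_fract (prod f S) = (\<Prod>i\<in>S. to_fract (f i))"
  by (induction S rule: infinite_finite_induct) simp_all

lemma to_fract_power: "to_fract (a ^ k) = to_fract a ^ k"
  by (induction k) simp_all

definition fract_fps :: "'a::idom fps \<Rightarrow> 'a fract fps" where
  "fract_fps f = Abs_fps (\<lambda>k. to_fract (fps_nth f k))"

lemma fract_fps_mult: "fract_fps (f * g) = fract_fps f * fract_fps g"
  by (rule fps_ext) (simp add: fract_fps_def fps_mult_nth)

lemma fract_fps_1: "fract_fps 1 = 1"
  by (rule fps_ext) (simp add: fract_fps_def)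

lemma fract_fps_prod: "fract_fps (prod f S) = (\<Prod>i\<in>S. fract_fps (f i))"
  by (induction S rule: infinite_finite_induct) (simp_all add: fract_fps_1 fract_fps_mult)

lemma fract_fps_linear:
  "fract_fps (1 - fps_const a * fps_X) = 1 - fps_const (to_fract a) * fps_X"
  by (rule fps_ext) (auto simp: fract_fps_def fps_X_def)

text \<open>
  The bound on \<open>r\<close> is sharp: for \<open>n > 0\<close> and \<open>r = - n\<close>, the left-hand side is 0, but the
  right-hand side is not. The sum in \<open>partial_fractions_gf\<close> differs from the present one by the shift \<open>m = r + n - 1\<close> of the exponent,
  which turns the vanishing low coefficients into \<open>h\<^sub>r = 0\<close> for \<open>-n < r < 0\<close>.
\<close>

lemma complete_sym_partial_fractions:
  assumes "r > - int n"
  shows "to_fract (complete_sym n r) = (\<Sum>i<n. \<xi> i powi r / (\<Prod>j\<in>{..<n} - {i}. 1 - \<xi> j / \<xi> i))"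
proof (cases "n = 0")
  case True
  then show ?thesis
    using assms complete_gf_inverse[of 0] by (simp add: complete_sym_def)
next
  case False
  define G where "G = Abs_fps (\<lambda>m. \<Sum>i<n. \<xi> i ^ m / (\<Prod>j\<in>{..<n} - {i}. \<xi> i - \<xi> j))"
  define E where "E = (\<Prod>i<n. 1 - fps_const (\<xi> i) * fps_X)"
  define H where "H = fract_fps (complete_gf n)"
  have "G * E = fps_X ^ (n - 1)"
    using partial_fractions_gf[of "{..<n}" \<xi>] inj_x False by (simp add: G_def E_def lessThan_empty_iff)
  moreover have "E * H = 1"
    using arg_cong[OF complete_gf_inverse[of n], of fract_fps]
    by (simp add: E_def H_def fract_fps_mult fract_fps_prod fract_fps_linear fract_fps_1)
  ultimately have G: "G = fps_X ^ (n - 1) * H"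
    by (metis mult.assoc mult.right_neutral)
  define m where "m = nat (r + int (n - 1))"
  have m: "int m = r + int (n - 1)" using assms False by (simp add: m_def)
  have "to_fract (complete_sym n r) = fps_nth G m"
    unfolding G fps_X_power_mult_nth
    using m by (auto simp: complete_sym_def H_def fract_fps_def nat_diff_distrib intro!: arg_cong[of _ _ "fps_nth _"])
  also have "\<dots> = (\<Sum>i<n. \<xi> i ^ m / (\<Prod>j\<in>{..<n} - {i}. \<xi> i - \<xi> j))"
    by (simp add: G_def)
  also have "\<dots> = (\<Sum>i<n. \<xi> i powi r / (\<Prod>j\<in>{..<n} - {i}. 1 - \<xi> j / \<xi> i))"
  proof (rule sum.cong)
    fix i assume i: "i \<in> {..<n}"
    have "\<xi> i ^ m = \<xi> i powi r * \<xi> i ^ (n - 1)"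
      using X_nonzero[of i] by (simp add: m power_int_add flip: power_int_of_nat)
    moreover have "(\<Prod>j\<in>{..<n} - {i}. \<xi> i - \<xi> j) =
        (\<Prod>j\<in>{..<n} - {i}. \<xi> i * (1 - \<xi> j / \<xi> i))"
      using X_nonzero[of i] by (intro prod.cong) (simp_all add: field_simps)
    moreover have "\<dots> = \<xi> i ^ (n - 1) * (\<Prod>j\<in>{..<n} - {i}. 1 - \<xi> j / \<xi> i)"
      using i by (simp add: prod.distrib)
    ultimately show "\<xi> i ^ m / (\<Prod>j\<in>{..<n} - {i}. \<xi> i - \<xi> j) =
        \<xi> i powi r / (\<Prod>j\<in>{..<n} - {i}. 1 - \<xi> j / \<xi> i)"
      using X_nonzero[of i] by simp
  qed simp
  finally show ?thesis .
qed

section \<open>Alternation of the difference product\<close>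

abbreviation pairs :: "nat \<Rightarrow> (nat \<times> nat) set" where
  "pairs n \<equiv> {(i, j). i < j \<and> j < n}"

lemma finite_pairs: "finite (pairs n)"
  by (rule finite_subset[of _ "{..<n} \<times> {..<n}"]) auto

definition diff_prod :: "nat \<Rightarrow> (nat \<Rightarrow> 'a::comm_ring_1) \<Rightarrow> 'a" where
  "diff_prod n y = (\<Prod>(i, j)\<in>pairs n. y j - y i)"

text \<open>
  An adjacent transposition preserves the order within every pair other than \<open>(a, a + 1)\<close>, so it
  permutes the remaining factors without a change of sign. For an arbitrary transposition this fails,
  whence the detour over words in adjacent transpositions.
\<close>

lemma diff_prod_adjacent:
  assumes "Suc a < n"
  shows "diff_prod n (y \<circ> Transposition.transpose a (Suc a)) = - diff_prod n y"
proof -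
  let ?t = "Transposition.transpose a (Suc a)"
  let ?P = "pairs n - {(a, Suc a)}"
  have a: "(a, Suc a) \<in> pairs n" using assms by simp
  have split: "diff_prod n z = (z (Suc a) - z a) * (\<Prod>(i, j)\<in>?P. z j - z i)" for z :: "nat \<Rightarrow> 'a"
    unfolding diff_prod_def using prod.remove[OF finite_pairs a, of "\<lambda>(i, j). z j - z i"] by simp
  have maps: "map_prod ?t ?t q \<in> ?P" if "q \<in> ?P" for q
    using that assms by (cases q) (auto simp: transpose_def split: if_splits)
  have "(\<Prod>(i, j)\<in>?P. (y \<circ> ?t) j - (y \<circ> ?t) i) = (\<Prod>(i, j)\<in>?P. y j - y i)"
    by (rule prod.reindex_bij_witness[of _ "map_prod ?t ?t" "map_prod ?t ?t"])
       (use maps in \<open>auto simp del: Diff_iff\<close>)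
  then show ?thesis
    unfolding split[of "y \<circ> ?t"] split[of y] by (simp add: algebra_simps)
qed

lemma diff_prod_adj_transps:
  assumes "\<forall>a\<in>set as. Suc a < n"
  shows "diff_prod n (y \<circ> apply_adj_transps as) = (- 1) ^ length as * diff_prod n y"
  using assms
proof (induction as arbitrary: y)
  case (Cons a as)
  have "diff_prod n (y \<circ> apply_adj_transps (a # as)) =
      diff_prod n ((y \<circ> Transposition.transpose a (Suc a)) \<circ> apply_adj_transps as)"
    by (simp add: o_assoc)
  also have "\<dots> = (- 1) ^ length (a # as) * diff_prod n y"
    using Cons by (simp add: diff_prod_adjacent del: o_apply)
  finally show ?case .
qed simp

lemma diff_prod_transpose:
  assumes "a < n" "b < n" "a \<noteq> b"
  shows "diff_prod n (y \<circ> Transposition.transpose a b) = - diff_prod n y"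
  using assms
proof (induction a b rule: linorder_wlog)
  case (le a b)
  then have "a < b" by simp
  then show ?case
    using diff_prod_adj_transps[of "adj_transp_seq a b" n y] le
    by (simp add: adj_transp_seq_correct length_adj_transp_seq set_adj_transp_seq del: o_apply)
next
  case (sym a b)
  then show ?case by (simp add: transpose_commute)
qed

lemma diff_prod_permutes:
  assumes "p permutes {..<n}"
  shows "diff_prod n (y \<circ> p) = signof p * diff_prod n y"
  using finite_lessThan assms
proof (induction rule: permutes_rev_induct)
  case id
  then show ?case by simp
next
  case (swap a b p)
  have "sign (p \<circ> Transposition.transpose a b) = - sign p"
    using swap permutes_imp_permutation[of "{..<n}" p]
    by (simp add: sign_compose sign_swap_id permutation_swap_id)
  moreover have "diff_prod n (y \<circ> (p \<circ> Transposition.transpose a b)) = - diff_prod n (y \<circ> p)"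
    using swap diff_prod_transpose[of a n b "y \<circ> p"] by (simp add: o_assoc del: o_apply)
  ultimately show ?case using swap by (simp del: o_apply)
qed

lemma prod_one_minus_ratio:
  fixes y :: "nat \<Rightarrow> 'a::field"
  assumes "\<And>k. k < n \<Longrightarrow> y k \<noteq> 0"
  shows "(\<Prod>(i, j)\<in>pairs n. 1 - y i / y j) = diff_prod n y / (\<Prod>k<n. y k ^ k)"
  using assms
proof (induction n)
  case 0
  then show ?case by (simp add: diff_prod_def)
next
  case (Suc n)
  have pairs: "pairs (Suc n) = pairs n \<union> (\<lambda>i. (i, n)) ` {..<n}"
    by (auto simp: less_Suc_eq)
  have split: "prod f (pairs (Suc n)) = prod f (pairs n) * (\<Prod>i<n. f (i, n))" for f :: "_ \<Rightarrow> 'a"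
    unfolding pairs
    by (subst prod.union_disjoint) (auto simp: finite_pairs prod.reindex inj_on_def)
  have "(\<Prod>i<n. 1 - y i / y n) = (\<Prod>i<n. (y n - y i) / y n)"
    using Suc.prems by (intro prod.cong) (auto simp: field_simps)
  also have "\<dots> = (\<Prod>i<n. y n - y i) / y n ^ n"
    by (simp add: prod_dividef)
  finally show ?case
    using Suc unfolding diff_prod_def split by simp
qed

section \<open>Raising operators\<close>

text \<open>
  Monomials are eigenvectors of the raising operators; the eigenvalue of \<open>R\<^sub>i\<^sub>j\<close> is \<open>y i / y j\<close>. This
  turns the expanded operator back into a product of numbers.
\<close>

lemma prod_powi_raising_monomial:
  fixes y :: "nat \<Rightarrow> 'a::field"
  assumes "P \<subseteq> pairs n" "\<And>k. k < n \<Longrightarrow> y k \<noteq> 0"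
  shows "(\<Prod>k<n. y k powi raising_monomial P \<alpha> k) =
    (\<Prod>k<n. y k powi \<alpha> k) * (\<Prod>(i, j)\<in>P. y i / y j)"
  using finite_subset[OF assms(1) finite_pairs] assms(1)
proof (induction P rule: finite_induct)
  case (insert q P)
  obtain i j where q: "q = (i, j)" by force
  have ij: "i < j" "j < n" using insert.prems q by auto
  define \<beta> where "\<beta> = raising_monomial P \<alpha>"
  have split: "(\<Prod>k<n. f k) = f i * (f j * (\<Prod>k\<in>{..<n} - {i} - {j}. f k))" for f :: "nat \<Rightarrow> 'a"
    using ij by (simp add: prod.remove[of _ i] prod.remove[of _ j])
  have rest: "(\<Prod>k\<in>{..<n} - {i} - {j}. y k powi raising i j \<beta> k) =
      (\<Prod>k\<in>{..<n} - {i} - {j}. y k powi \<beta> k)"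
    by (intro prod.cong) (auto simp: raising_def)
  have "(\<Prod>k<n. y k powi raising i j \<beta> k) = (\<Prod>k<n. y k powi \<beta> k) * (y i / y j)"
    unfolding split[of "\<lambda>k. y k powi raising i j \<beta> k"] split[of "\<lambda>k. y k powi \<beta> k"] rest
    using ij assms(2)[of i] assms(2)[of j]
    by (simp add: raising_def power_int_add power_int_diff)
  then show ?case
    using insert q by (simp add: raising_monomial_insert \<beta>_def)
qed simp

lemma sum_raising_monomial:
  fixes y :: "nat \<Rightarrow> 'a::field"
  assumes "\<And>k. k < n \<Longrightarrow> y k \<noteq> 0"
  shows "(\<Sum>P\<in>Pow (pairs n). (- 1) ^ card P * (\<Prod>k<n. y k powi raising_monomial P \<alpha> k)) =
    (\<Prod>k<n. y k powi \<alpha> k) * (\<Prod>(i, j)\<in>pairs n. 1 - y i / y j)"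
proof -
  have "(\<Prod>(i, j)\<in>pairs n. 1 - y i / y j) =
      (\<Sum>P\<in>Pow (pairs n). (- 1) ^ card P * (\<Prod>(i, j)\<in>P. y i / y j))"
    using prod_diff_conv_sum[OF finite_pairs[of n], of "\<lambda>_. 1" "\<lambda>(i, j). y i / y j"]
    by (simp add: case_prod_unfold)
  then show ?thesis
    using assms by (auto simp: sum_distrib_left prod_powi_raising_monomial intro!: sum.cong)
qed

text \<open>
  Each pair \<open>(i, k)\<close> with \<open>i < k\<close> lowers position \<open>k\<close> by one, so that \<open>\<alpha> k - k\<close> is the least possible
  value. This keeps all indices in the range where \<open>complete_sym_partial_fractions\<close> applies.
\<close>

lemma raising_monomial_gt:
  assumes "P \<subseteq> pairs n" "k < n" "\<alpha> k \<ge> 0"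
  shows "raising_monomial P \<alpha> k > - int n"
proof -
  have "{p \<in> P. snd p = k} \<subseteq> (\<lambda>i. (i, k)) ` {..<k}"
    using assms(1) by auto
  then have "card {p \<in> P. snd p = k} \<le> k"
    using card_mono[of "(\<lambda>i. (i, k)) ` {..<k}" "{p \<in> P. snd p = k}"]
      card_image[of "\<lambda>i. (i, k)" "{..<k}"] by (simp add: inj_on_def)
  moreover have "raising_monomial P \<alpha> k =
      \<alpha> k + int (card {p \<in> P. fst p = k}) - int (card {p \<in> P. snd p = k})"
    using assms(1) finite_subset[OF assms(1) finite_pairs] by (intro raising_monomial_eq) auto
  ultimately show ?thesis using assms by linarith
qed

lemma complete_seq_eq_prod:
  assumes "\<And>i. i \<ge> n \<Longrightarrow> \<alpha> i = 0"
  shows "complete_seq m \<alpha> = (\<Prod>i<n. complete_sym m (\<alpha> i))"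
  unfolding complete_seq_def
  using assms by (intro prod.mono_neutral_left) (auto simp: not_le[symmetric])

lemma raising_monomial_outside:
  assumes "P \<subseteq> pairs n" "k \<ge> n"
  shows "raising_monomial P \<alpha> k = \<alpha> k"
proof -
  have none: "{p \<in> P. fst p = k} = {}" "{p \<in> P. snd p = k} = {}"
    using assms by auto
  have "raising_monomial P \<alpha> k =
      \<alpha> k + int (card {p \<in> P. fst p = k}) - int (card {p \<in> P. snd p = k})"
    using assms(1) finite_subset[OF assms(1) finite_pairs] by (intro raising_monomial_eq) auto
  then show ?thesis by (simp only: none card.empty)
qed

section \<open>From functions to permutations\<close>

text \<open>
  Functions in \<open>S \<rightarrow>\<^sub>E S\<close> are undefined outside \<open>S\<close>, whereas permutations of \<open>S\<close> are the identity
  there; the first condition on \<open>F\<close> makes this difference invisible.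
\<close>

lemma sum_PiE_eq_sum_permutes:
  fixes F :: "('b \<Rightarrow> 'b) \<Rightarrow> 'a::comm_monoid_add"
  assumes "finite S"
    and "\<And>f g. (\<And>k. k \<in> S \<Longrightarrow> f k = g k) \<Longrightarrow> F f = F g"
    and "\<And>f. f \<in> S \<rightarrow> S \<Longrightarrow> \<not> inj_on f S \<Longrightarrow> F f = 0"
  shows "(\<Sum>f\<in>S \<rightarrow>\<^sub>E S. F f) = (\<Sum>p | p permutes S. F p)"
proof -
  have "(\<Sum>f\<in>S \<rightarrow>\<^sub>E S. F f) = (\<Sum>f | f \<in> S \<rightarrow>\<^sub>E S \<and> inj_on f S. F f)"
    using assms(1,3) by (intro sum.mono_neutral_right) (auto simp: finite_PiE)
  also have "\<dots> = (\<Sum>p | p permutes S. F p)"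
  proof (rule sum.reindex_bij_witness[of _ "\<lambda>p. restrict p S" "\<lambda>f k. if k \<in> S then f k else k"])
    fix f assume "f \<in> {f. f \<in> S \<rightarrow>\<^sub>E S \<and> inj_on f S}"
    then have f: "f \<in> S \<rightarrow>\<^sub>E S" "inj_on f S" by auto
    show "restrict (\<lambda>k. if k \<in> S then f k else k) S = f"
      using f by (auto simp: PiE_def extensional_def fun_eq_iff)
    show "(\<lambda>k. if k \<in> S then f k else k) \<in> {p. p permutes S}"
      using f assms(1) by (auto intro!: inj_imp_permutes simp: inj_on_def)
    show "F (\<lambda>k. if k \<in> S then f k else k) = F f"
      by (rule assms(2)) simp
  next
    fix p assume "p \<in> {p. p permutes S}"
    then have p: "p permutes S" by simp
    show "(\<lambda>k. if k \<in> S then restrict p S k else k) = p"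
      using permutes_not_in[OF p] by (auto simp: fun_eq_iff)
    show "restrict p S \<in> {f. f \<in> S \<rightarrow>\<^sub>E S \<and> inj_on f S}"
      using permutes_in_image[OF p] permutes_inj_on[OF p] by (auto simp: inj_on_restrict_eq)
  qed
  finally show ?thesis .
qed

text \<open>
  If \<open>f i = f j\<close> for some \<open>i < j\<close>, the eigenvalue \<open>1 - \<xi> (f i) / \<xi> (f j)\<close> of \<open>1 - R\<^sub>i\<^sub>j\<close> vanishes. Hence
  only permutations survive from the functions \<open>f\<close> in the expansion of the products \<open>h\<^sub>\<beta>\<close>.
\<close>

lemma schur_eq_sum_permutes:
  assumes "\<And>i. \<alpha> i \<ge> 0" "\<And>i. i \<ge> n \<Longrightarrow> \<alpha> i = 0"
  defines "u \<equiv> \<lambda>i. 1 / (\<Prod>j\<in>{..<n} - {i}. 1 - \<xi> j / \<xi> i)"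
  shows "to_fract (schur n \<alpha>) = (\<Sum>p | p permutes {..<n}.
    (\<Prod>k<n. u (p k)) * ((\<Prod>k<n. \<xi> (p k) powi \<alpha> k) * (\<Prod>(i, j)\<in>pairs n. 1 - \<xi> (p i) / \<xi> (p j))))"
proof -
  let ?M = "\<lambda>P. raising_monomial P \<alpha>"
  let ?F = "{..<n} \<rightarrow>\<^sub>E {..<n}"
  have h: "to_fract (complete_seq n (?M P)) =
      (\<Sum>f\<in>?F. (\<Prod>k<n. u (f k)) * (\<Prod>k<n. \<xi> (f k) powi ?M P k))" if P: "P \<subseteq> pairs n" for P
  proof -
    have "to_fract (complete_seq n (?M P)) = (\<Prod>k<n. to_fract (complete_sym n (?M P k)))"
      using raising_monomial_outside[OF P] assms(2)
      by (subst complete_seq_eq_prod[of n]) (simp_all add: to_fract_prod)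
    also have "\<dots> = (\<Prod>k<n. \<Sum>i<n. u i * \<xi> i powi ?M P k)"
      using raising_monomial_gt[OF P, of _ \<alpha>] assms(1)
      by (intro prod.cong) (simp_all add: complete_sym_partial_fractions u_def)
    also have "\<dots> = (\<Sum>f\<in>?F. \<Prod>k<n. u (f k) * \<xi> (f k) powi ?M P k)"
      by (rule prod_sum_PiE) auto
    finally show ?thesis by (simp add: prod.distrib)
  qed
  have "to_fract (schur n \<alpha>) = (\<Sum>P\<in>Pow (pairs n). (- 1) ^ card P *
      (\<Sum>f\<in>?F. (\<Prod>k<n. u (f k)) * (\<Prod>k<n. \<xi> (f k) powi ?M P k)))"
    using assms(2) by (subst schur_eq_finite_sum[of n]) (auto simp: to_fract_power h)
  also have "\<dots> = (\<Sum>f\<in>?F. (\<Prod>k<n. u (f k)) *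
      (\<Sum>P\<in>Pow (pairs n). (- 1) ^ card P * (\<Prod>k<n. \<xi> (f k) powi ?M P k)))"
    unfolding sum_distrib_left by (subst sum.swap) (simp add: ac_simps)
  also have "\<dots> = (\<Sum>f\<in>?F. (\<Prod>k<n. u (f k)) *
      ((\<Prod>k<n. \<xi> (f k) powi \<alpha> k) * (\<Prod>(i, j)\<in>pairs n. 1 - \<xi> (f i) / \<xi> (f j))))"
    by (subst sum_raising_monomial) (simp_all add: X_nonzero)
  also have "\<dots> = (\<Sum>p | p permutes {..<n}. (\<Prod>k<n. u (p k)) *
      ((\<Prod>k<n. \<xi> (p k) powi \<alpha> k) * (\<Prod>(i, j)\<in>pairs n. 1 - \<xi> (p i) / \<xi> (p j))))"
  proof (rule sum_PiE_eq_sum_permutes)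
    fix f :: "nat \<Rightarrow> nat"
    assume "\<not> inj_on f {..<n}"
    then obtain i j where "i \<noteq> j" "i < n" "j < n" "f i = f j"
      by (auto simp: inj_on_def)
    then obtain i j where ij: "i < j" "j < n" "f i = f j"
      by (metis nat_neq_iff)
    then have "(\<Prod>(i, j)\<in>pairs n. 1 - \<xi> (f i) / \<xi> (f j)) = 0"
      using X_nonzero by (intro prod_zero finite_pairs bexI[of _ "(i, j)"]) auto
    then show "(\<Prod>k<n. u (f k)) * ((\<Prod>k<n. \<xi> (f k) powi \<alpha> k) *
        (\<Prod>(i, j)\<in>pairs n. 1 - \<xi> (f i) / \<xi> (f j))) = 0" by simp
  next
    fix f g :: "nat \<Rightarrow> nat"
    assume "\<And>k. k \<in> {..<n} \<Longrightarrow> f k = g k"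
    then show "(\<Prod>k<n. u (f k)) * ((\<Prod>k<n. \<xi> (f k) powi \<alpha> k) *
        (\<Prod>(i, j)\<in>pairs n. 1 - \<xi> (f i) / \<xi> (f j))) =
      (\<Prod>k<n. u (g k)) * ((\<Prod>k<n. \<xi> (g k) powi \<alpha> k) *
        (\<Prod>(i, j)\<in>pairs n. 1 - \<xi> (g i) / \<xi> (g j)))"
      by (intro arg_cong2[of _ _ _ _ "(*)"] prod.cong) auto
  qed simp
  finally show ?thesis .
qed

section \<open>The bialternant formula\<close>

lemma to_fract_signof: "to_fract (signof p) = signof p"
  by (simp add: sign_def)

lemma permutes_nat_less: "p permutes {..<n::nat} \<Longrightarrow> k < n \<Longrightarrow> p k < n"
  using permutes_in_image[of p "{..<n}" k] by simp

lemma to_fract_alternant: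
  "to_fract (det (mat n n (\<lambda>(i, j). X i ^ e j))) =
    (\<Sum>p | p permutes {..<n}. signof p * (\<Prod>k<n. \<xi> (p k) ^ e k))"
proof -
  have "det (mat n n (\<lambda>(i, j). X i ^ e j)) =
      (\<Sum>p | p permutes {..<n}. signof p * (\<Prod>k<n. X (p k) ^ e k))"
    by (subst det_col[of _ n])
       (auto simp: atLeast0LessThan dest: permutes_nat_less intro!: sum.cong prod.cong)
  then show ?thesis
    by (simp add: to_fract_signof to_fract_prod to_fract_power)
qed

text \<open>
  Two things depend on the permutation in \<open>schur_eq_sum_permutes\<close> besides the monomial: the product
  of the \<open>u (p k)\<close>, which is symmetric, and the product of the \<open>1 - \<xi> (p i) / \<xi> (p j)\<close>, which is
  alternating up to the monomial \<open>\<Prod>k<n. \<xi> (p k) ^ k\<close>. The latter, completed by the symmetric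
  \<open>\<Prod>k<n. \<xi> k ^ (n - 1)\<close> in \<open>K\<close>, shifts the exponents by \<open>n - 1 - k\<close>.
\<close>

lemma schur_proportional_alternant:
  obtains K where "\<And>l. (\<And>i. i \<ge> n \<Longrightarrow> l i = 0) \<Longrightarrow> to_fract (schur n (\<lambda>i. int (l i))) =
    K * to_fract (det (mat n n (\<lambda>(i, j). X i ^ (l j + (n - 1 - j)))))"
proof
  define u where "u i = 1 / (\<Prod>j\<in>{..<n} - {i}. 1 - \<xi> j / \<xi> i)" for i
  define K where "K = (\<Prod>k<n. u k) * diff_prod n \<xi> / (\<Prod>k<n. \<xi> k ^ (n - 1))"
  fix l :: "nat \<Rightarrow> nat"
  assume l: "\<And>i. i \<ge> n \<Longrightarrow> l i = 0"
  have summand: "(\<Prod>k<n. u (p k)) *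
      ((\<Prod>k<n. \<xi> (p k) powi int (l k)) * (\<Prod>(i, j)\<in>pairs n. 1 - \<xi> (p i) / \<xi> (p j))) =
      K * (signof p * (\<Prod>k<n. \<xi> (p k) ^ (l k + (n - 1 - k))))" if p: "p permutes {..<n}" for p
  proof -
    have inv: "(\<Prod>k<n. f (p k)) = (\<Prod>k<n. f k)" for f :: "nat \<Rightarrow> zpoly fract"
      using prod.permute[OF p, of f] by (simp add: o_def)
    have ratio: "(\<Prod>(i, j)\<in>pairs n. 1 - \<xi> (p i) / \<xi> (p j)) =
        signof p * diff_prod n \<xi> / (\<Prod>k<n. \<xi> (p k) ^ k)"
      using prod_one_minus_ratio[of n "\<xi> \<circ> p"] diff_prod_permutes[OF p, of \<xi>] X_nonzero
      by (simp add: o_def)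
    have "\<xi> (p k) ^ l k / \<xi> (p k) ^ k = \<xi> (p k) ^ (l k + (n - 1 - k)) / \<xi> (p k) ^ (n - 1)"
      if "k < n" for k
      using that X_nonzero[of "p k"] by (simp add: divide_simps flip: power_add)
    then have "(\<Prod>k<n. \<xi> (p k) ^ l k) / (\<Prod>k<n. \<xi> (p k) ^ k) =
        (\<Prod>k<n. \<xi> (p k) ^ (l k + (n - 1 - k))) / (\<Prod>k<n. \<xi> (p k) ^ (n - 1))"
      by (simp flip: prod_dividef)
    also have "(\<Prod>k<n. \<xi> (p k) ^ (n - 1)) = (\<Prod>k<n. \<xi> k ^ (n - 1))"
      by (rule inv)
    finally have quot: "(\<Prod>k<n. \<xi> (p k) ^ l k) / (\<Prod>k<n. \<xi> (p k) ^ k) =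
        (\<Prod>k<n. \<xi> (p k) ^ (l k + (n - 1 - k))) / (\<Prod>k<n. \<xi> k ^ (n - 1))" .
    have "(\<Prod>k<n. u (p k)) *
        ((\<Prod>k<n. \<xi> (p k) powi int (l k)) * (\<Prod>(i, j)\<in>pairs n. 1 - \<xi> (p i) / \<xi> (p j))) =
        (\<Prod>k<n. u k) * (signof p * diff_prod n \<xi> *
          ((\<Prod>k<n. \<xi> (p k) ^ l k) / (\<Prod>k<n. \<xi> (p k) ^ k)))"
      by (simp add: ratio inv[of u])
    also have "\<dots> = K * (signof p * (\<Prod>k<n. \<xi> (p k) ^ (l k + (n - 1 - k))))"
      unfolding quot K_def by simp
    finally show ?thesis .
  qed
  show "to_fract (schur n (\<lambda>i. int (l i))) =
    K * to_fract (det (mat n n (\<lambda>(i, j). X i ^ (l j + (n - 1 - j)))))"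
  proof -
    have "to_fract (schur n (\<lambda>i. int (l i))) = (\<Sum>p | p permutes {..<n}. (\<Prod>k<n. u (p k)) *
        ((\<Prod>k<n. \<xi> (p k) powi int (l k)) * (\<Prod>(i, j)\<in>pairs n. 1 - \<xi> (p i) / \<xi> (p j))))"
      unfolding u_def by (rule schur_eq_sum_permutes) (simp_all add: l)
    also have "\<dots> = (\<Sum>p | p permutes {..<n}.
        K * (signof p * (\<Prod>k<n. \<xi> (p k) ^ (l k + (n - 1 - k)))))"
      by (intro sum.cong) (simp_all only: mem_Collect_eq summand)
    finally show ?thesis
      by (simp only: to_fract_alternant sum_distrib_left)
  qed
qed

lemma schur_zero: "schur n (\<lambda>_. 0) = 1"
  \<comment> \<open>The zero sequence has length 0, so that only the empty set of pairs contributes.\<close>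
  by (subst schur_eq_finite_sum[of 0]) (simp_all add: complete_seq_def)

theorem mainTheorem11:
  fixes n :: nat and l :: "nat \<Rightarrow> nat"
  assumes "n \<ge> 1"
    and "antimono l"
    and "\<And>i. i \<ge> n \<Longrightarrow> l i = 0"
  shows "to_fract (schur n (\<lambda>i. int (l i))) =
    to_fract (det (mat n n (\<lambda>(i, j). X i ^ (l j + (n - 1 - j))))) /
    to_fract (det (mat n n (\<lambda>(i, j). X i ^ (n - 1 - j))))"
proof -
  let ?a = "\<lambda>l. to_fract (det (mat n n (\<lambda>(i, j). X i ^ (l j + (n - 1 - j)))))"
  obtain K where K: "\<And>l. (\<And>i. i \<ge> n \<Longrightarrow> l i = 0) \<Longrightarrow> to_fract (schur n (\<lambda>i. int (l i))) = K * ?a l"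
    using schur_proportional_alternant[of n] by blast
  have "K * ?a (\<lambda>_. 0) = 1"
    using K[of "\<lambda>_. 0"] by (simp add: schur_zero)
  then have "K = 1 / ?a (\<lambda>_. 0)"
    by (metis eq_divide_imp mult_zero_right zero_neq_one)
  then show ?thesis
    using K[of l] assms by simp
qed

end
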